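(* Let $n$ be a positive integer. Then $$ex^{lin}_4(n,E_4^+) \ge 12\left\lfloor\frac{n-4}{9}\right\rfloor+\varepsilon,$$ where $\varepsilon=0$ if $n-4\equiv 0,1,2 \pmod 9$, $\varepsilon=1$ if $n-4\equiv 3,4 \pmod 9$, $\varepsilon=2$ if $n-4\equiv 5\pmod 9$, $\varepsilon=4$ if $n-4\equiv 6 \pmod 9$, $\varepsilon=5$ if $n-4\equiv 7\pmod 9$, and $\varepsilon=8$ if $n-4\equiv 8 \pmod 9$. Moreover, every $E_4^+$-free linear 4-uniform hypergraph $G$ on $n$ vertices satisfies $$|E(G)|\le \frac{14(n-s)}{9},$$ where $s$ is the number of vertices of $G$ with degree at least $8$.
   Context: A 4-uniform hypergraph $G=(V(G),E(G))$ consists of a finite vertex set and a set of 4-element subsets of it, called edges or quadruples. It is linear if every pair of vertices is contained in at most one edge. The degree of a vertex is the number of edges containing it. $G$ is $F$-free if it contains no subhypergraph isomorphic to $F$ (not necessarily induced). $ex^{lin}_4(n,F)$ is the maximum number of edges in an $F$-free linear 4-uniform hypergraph on $n$ vertices. $E_4^+$ is the linear 4-uniform hypergraph (on 13 vertices) consisting of three pairwise disjoint quadruples and a fourth quadruple that intersects each of these three in exactly one vertex. *)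

theory Defs
  imports Complex_Main
begin

record 'a hypergraph =
  verts :: "'a set"
  edges :: "'a set set"

definition four_uniform :: "'a hypergraph \<Rightarrow> bool" where
  "four_uniform G \<longleftrightarrow>
     finite (verts G) \<and> (\<forall>e\<in>edges G. e \<subseteq> verts G \<and> card e = 4)"

definition linear_hypergraph :: "'a hypergraph \<Rightarrow> bool" where
  "linear_hypergraph G \<longleftrightarrow>
     (\<forall>x\<in>verts G. \<forall>y\<in>verts G. x \<noteq> y \<longrightarrow>
        (\<forall>e\<in>edges G. \<forall>f\<in>edges G. {x, y} \<subseteq> e \<and> {x, y} \<subseteq> f \<longrightarrow> e = f))"

definition degree :: "'a hypergraph \<Rightarrow> 'a \<Rightarrow> nat" where
  "degree G v = card {e \<in> edges G. v \<in> e}"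

definition subhypergraph :: "'a hypergraph \<Rightarrow> 'a hypergraph \<Rightarrow> bool" where
  "subhypergraph H G \<longleftrightarrow>
     verts H \<subseteq> verts G \<and> edges H \<subseteq> edges G \<and> (\<forall>e\<in>edges H. e \<subseteq> verts H)"

definition isomorphic :: "'a hypergraph \<Rightarrow> 'b hypergraph \<Rightarrow> bool" where
  "isomorphic F H \<longleftrightarrow>
     (\<exists>\<phi>. bij_betw \<phi> (verts F) (verts H) \<and> edges H = (\<lambda>e. \<phi> ` e) ` edges F)"

definition free_of :: "'b hypergraph \<Rightarrow> 'a hypergraph \<Rightarrow> bool" where
  "free_of F G \<longleftrightarrow> \<not> (\<exists>H. subhypergraph H G \<and> isomorphic F H)"

text \<open>Every hypergraph with a finite vertex set is isomorphic to one whose vertices are natural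
  numbers, so the maximum may be taken over those. The set is finite; it is nonempty whenever
  \<open>F\<close> has an edge (take \<open>n\<close> isolated vertices).\<close>

definition ex_lin4 :: "nat \<Rightarrow> 'b hypergraph \<Rightarrow> nat" where
  "ex_lin4 n F =
     Max {card (edges G) | G :: nat hypergraph.
            four_uniform G \<and> linear_hypergraph G \<and> card (verts G) = n \<and> free_of F G}"

definition E4_plus :: "nat hypergraph" where
  "E4_plus = \<lparr> verts = {0..<13},
               edges = {{0, 1, 2, 3}, {4, 5, 6, 7}, {8, 9, 10, 11}, {0, 4, 8, 12}} \<rparr>"

definition lower_eps :: "int \<Rightarrow> int" where
  "lower_eps m =
     (if m mod 9 \<in> {0, 1, 2} then 0
      else if m mod 9 \<in> {3, 4} then 1
      else if m mod 9 = 5 then 2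
      else if m mod 9 = 6 then 4
      else if m mod 9 = 7 then 5
      else 8)"

end

theory Submission
  imports Defs
begin

text \<open>
The lower bound glues affine planes of order \<open>3\<close> along common points at infinity. Extend each of the
twelve lines of an affine plane by the point at infinity of its parallel class, and use the same four
points at infinity for all planes. Any two edges in the same block (an extended plane) meet. An edge
has only one point at infinity; hence of three edges that meet it in different points, two pass
through affine points, lie in its block, and are not disjoint. So there is no \<open>E4_plus\<close>. Each block
costs nine points and contributes twelve edges; the remaining \<open>r < 9\<close> points carry a smaller block
with the same property.

The upper bound is proved by discharging. Each point of degree \<open>d < 8\<close> gives \<open>1 / d\<close> to each of its
edges, and the aim is that every edge receives at least \<open>9 / 14\<close>. Choosing disjoint edges greedily
(\<open>greedy\<close>) settles the edges with a point of degree at least \<open>8\<close>. If all degrees are at most \<open>7\<close>, an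
edge \<open>e\<close> receives too little only if two of its points \<open>a\<close>, \<open>b\<close> have degree \<open>7\<close> and the degrees of the
other two, \<open>c\<close> and \<open>d\<close>, add up to at least \<open>12\<close>. Such edges exist: the line at infinity can be added
to two glued planes. In general, without \<open>E4_plus\<close>, the six other edges at \<open>a\<close> and the six at \<open>b\<close>
form the rows and columns of two \<open>3 \<times> 3\<close> grids (\<open>ex_halves\<close>), and the at least ten other edges at
\<open>c\<close> and \<open>d\<close> are transversals of these grids (\<open>transversal_side\<close>). At most two edges are thus missing
from two full affine planes. So little room is left for other edges at the points of the grids that
these points have degree at most \<open>6\<close>, and the three degrees on a row add up to at most \<open>14\<close>
(\<open>row_degrees\<close>). The points on a row other than \<open>a\<close> therefore give it \<open>9 / 14\<close> already, and \<open>a\<close> can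
give its whole charge to \<open>e\<close>.
\<close>

section \<open>Copies of the forbidden hypergraph\<close>

lemma free_of_E4_plusI:
  fixes G :: "'a hypergraph"
  assumes "\<And>e f g h p q r. \<lbrakk>e \<in> edges G; f \<in> edges G; g \<in> edges G; h \<in> edges G;
      p \<in> e; q \<in> e; r \<in> e; p \<in> f; q \<in> g; r \<in> h; f \<inter> g = {}; f \<inter> h = {}; g \<inter> h = {}\<rbrakk> \<Longrightarrow> False"
  shows "free_of E4_plus G"
  unfolding free_of_def
proof
  assume "\<exists>H. subhypergraph H G \<and> isomorphic E4_plus H"
  then obtain H \<phi> where H: "subhypergraph H G"
    and \<phi>: "bij_betw \<phi> (verts E4_plus) (verts H)" "edges H = (\<lambda>e. \<phi> ` e) ` edges E4_plus"
    unfolding isomorphic_def by blast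
  have inj: "inj_on \<phi> {0..<13}" using \<phi>(1) by (auto simp: bij_betw_def E4_plus_def)
  have mem: "\<phi> ` {0,1,2,3} \<in> edges G" "\<phi> ` {4,5,6,7} \<in> edges G" "\<phi> ` {8,9,10,11} \<in> edges G"
    "\<phi> ` {0,4,8,12} \<in> edges G"
    using H \<phi>(2) by (simp_all add: subhypergraph_def E4_plus_def)
  have disj: "\<phi> ` A \<inter> \<phi> ` B = {}" if "A \<subseteq> {0..<13}" "B \<subseteq> {0..<13}" "A \<inter> B = {}" for A B
    using inj_on_image_Int[OF inj that(1,2)] that(3) by simp
  show False
    by (rule assms[OF mem(4) mem(1-3), of "\<phi> 0" "\<phi> 4" "\<phi> 8"])
      (simp, simp, simp, simp, simp, simp, (rule disj; simp)+)
qed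

text \<open>The points \<open>p\<close>, \<open>q\<close>, \<open>r\<close> are distinct because \<open>f\<close>, \<open>g\<close>, \<open>h\<close> are disjoint. A second common point
of \<open>e\<close> and \<open>f\<close> would give \<open>e = f\<close> by linearity, against \<open>q \<in> e \<inter> g\<close>, and likewise for \<open>g\<close> and \<open>h\<close>.
So the four edges have thirteen points and form a copy of \<open>E4_plus\<close>.\<close>

lemma free_of_E4_plusD:
  fixes G :: "'a hypergraph"
  assumes G: "four_uniform G" "linear_hypergraph G" "free_of E4_plus G"
    and E: "e \<in> edges G" "f \<in> edges G" "g \<in> edges G" "h \<in> edges G"
    and pqr: "p \<in> e" "q \<in> e" "r \<in> e" "p \<in> f" "q \<in> g" "r \<in> h"
    and disj: "f \<inter> g = {}" "f \<inter> h = {}" "g \<inter> h = {}"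
  shows False
proof -
  have c4: "card e = 4" "card f = 4" "card g = 4" "card h = 4"
    and sub: "e \<subseteq> verts G" "f \<subseteq> verts G" "g \<subseteq> verts G" "h \<subseteq> verts G"
    using G(1) E by (auto simp: four_uniform_def)
  have lin: "x = y" if "x \<in> e" "y \<in> e" "x \<in> k" "y \<in> k" "k \<in> edges G" "k \<noteq> e" for x y k
  proof (rule ccontr)
    assume "x \<noteq> y"
    then have "e = k" using G(2) E(1) that sub(1) unfolding linear_hypergraph_def by blast
    then show False using that by simp
  qed
  have ne: "p \<noteq> q" "p \<noteq> r" "q \<noteq> r" "f \<noteq> e" "g \<noteq> e" "h \<noteq> e" using pqr disj by auto
  have "card (e - {p, q, r}) = 1" using c4 pqr ne by (simp add: card_Diff_subset)
  then obtain s where s: "e - {p, q, r} = {s}" by (auto simp: card_1_singleton_iff)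
  have "card (f - {p}) = 3" "card (g - {q}) = 3" "card (h - {r}) = 3" using c4 pqr by auto
  then obtain f1 f2 f3 g1 g2 g3 h1 h2 h3
    where F: "f - {p} = {f1, f2, f3}" "distinct [f1, f2, f3]"
      and Gg: "g - {q} = {g1, g2, g3}" "distinct [g1, g2, g3]"
      and Hh: "h - {r} = {h1, h2, h3}" "distinct [h1, h2, h3]"
    unfolding card_3_iff by (metis distinct_length_2_or_more distinct_singleton)
  have f: "f = {p, f1, f2, f3}" "p \<notin> {f1, f2, f3}" using F pqr by blast+
  have g: "g = {q, g1, g2, g3}" "q \<notin> {g1, g2, g3}" using Gg pqr by blast+
  have h: "h = {r, h1, h2, h3}" "r \<notin> {h1, h2, h3}" using Hh pqr by blast+
  have e: "e = {p, q, r, s}" "s \<notin> {p, q, r}" using s pqr by blast+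
  have se: "s \<in> e" using e by simp
  have sn: "s \<notin> f" "s \<notin> g" "s \<notin> h"
    using lin[OF se pqr(1) _ pqr(4) E(2) ne(4)] lin[OF se pqr(2) _ pqr(5) E(3) ne(5)]
      lin[OF se pqr(3) _ pqr(6) E(4) ne(6)] e(2) by blast+
  define vs where "vs = [p, f1, f2, f3, q, g1, g2, g3, r, h1, h2, h3, s]"
  have d: "distinct vs"
    using F(2) Gg(2) Hh(2) f(2) g(2) h(2) disj sn e(2) unfolding vs_def f(1) g(1) h(1) by auto
  define H where "H = \<lparr>verts = set vs, edges = {f, g, h, e}\<rparr>"
  have vs: "set vs = e \<union> f \<union> g \<union> h" unfolding vs_def e f g h by auto
  have "subhypergraph H G"
    using sub E unfolding subhypergraph_def H_def by (auto simp: vs)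
  moreover have "isomorphic E4_plus H"
    unfolding isomorphic_def
  proof (intro exI conjI)
    have "{0..<13} = {..<length vs}" by (auto simp: vs_def)
    then show "bij_betw ((!) vs) (verts E4_plus) (verts H)"
      using bij_betw_nth[OF d, of "{..<length vs}" "set vs"] by (simp add: E4_plus_def H_def)
    have "(!) vs ` {0,1,2,3} = f" "(!) vs ` {4,5,6,7} = g" "(!) vs ` {8,9,10,11} = h"
      "(!) vs ` {0,4,8,12} = e"
      by (simp_all add: vs_def e f g h)
    then show "edges H = (\<lambda>e. (!) vs ` e) ` edges E4_plus"
      by (simp add: E4_plus_def H_def)
  qed
  ultimately show False using G(3) by (auto simp: free_of_def)
qed

section \<open>Affine planes glued at infinity\<close>

text \<open>The lines of the projective plane of order \<open>3\<close> other than the line \<open>{0, 1, 2, 3}\<close>. The points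
\<open>4, \<dots>, 12\<close> form the affine plane, and \<open>0, \<dots>, 3\<close> are the directions of its parallel classes.\<close>

definition plane_lines :: "nat set set" where
  "plane_lines =
    {{0,4,5,6}, {0,7,8,9}, {0,10,11,12}, {1,4,7,10}, {1,5,8,11}, {1,6,9,12},
     {2,4,9,11}, {2,5,7,12}, {2,6,8,10}, {3,4,8,12}, {3,5,9,10}, {3,6,7,11}}"

text \<open>For \<open>r = 7, 8\<close> these are the lines that avoid the last \<open>9 - r\<close> affine points. For \<open>r = 6\<close>
the Pasch configuration, four triples on six points that pairwise meet, is better than what remains
of the plane; its triples are extended by the four different points at infinity.\<close>

definition partial_block :: "nat \<Rightarrow> nat set set" where
  "partial_block r =
    (if r = 8 then {{0,4,5,6}, {0,7,8,9}, {1,4,7,10}, {1,5,8,11},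
                    {2,4,9,11}, {2,6,8,10}, {3,5,9,10}, {3,6,7,11}}
     else if r = 7 then {{0,4,5,6}, {0,7,8,9}, {1,4,7,10}, {2,6,8,10}, {3,5,9,10}}
     else if r = 6 then {{0,4,5,6}, {1,4,7,8}, {2,5,7,9}, {3,6,8,9}}
     else if r = 5 then {{0,4,5,6}, {1,4,7,8}}
     else if r \<in> {3, 4} then {{0,4,5,6}}
     else {})"

text \<open>Points below \<open>4\<close> are the points at infinity, which all blocks will share.\<close>

definition block :: "nat \<Rightarrow> nat set set \<Rightarrow> bool" where
  "block m B \<longleftrightarrow>
     (\<forall>x\<in>B. card x = 4 \<and> x \<subseteq> {..<m} \<and> (\<forall>u\<in>x. \<forall>v\<in>x. u < 4 \<longrightarrow> v < 4 \<longrightarrow> u = v)) \<and>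
     (\<forall>x\<in>B. \<forall>y\<in>B. x \<noteq> y \<longrightarrow> is_singleton (x \<inter> y))"

lemma block_plane_lines: "block 13 plane_lines"
  unfolding block_def plane_lines_def is_singleton_altdef by simp

lemma block_partial: "r < 9 \<Longrightarrow> block (4 + r) (partial_block r)"
  unfolding block_def partial_block_def is_singleton_altdef by simp

lemma card_plane_lines: "card plane_lines = 12"
  unfolding plane_lines_def by (simp add: card_insert_if set_eq_subset)

lemma card_partial_block:
  "r < 9 \<Longrightarrow> int (card (partial_block r)) = lower_eps (int r)"
proof -
  assume "r < 9"
  then have "r \<in> {0,1,2,3,4,5,6,7,8}" by auto
  then show ?thesis
    by (elim insertE emptyE)
      (simp_all add: partial_block_def lower_eps_def card_insert_if set_eq_subset)
qed

text \<open>Blocks keep their points at infinity and move their affine points to the \<open>i\<close>-th interval of length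
\<open>9\<close> above \<open>4\<close>.\<close>

definition lift :: "nat \<Rightarrow> nat \<Rightarrow> nat" where
  "lift i a = (if a < 4 then a else a + 9 * i)"

lemma lift_eqD: "lift i a = lift j b \<Longrightarrow> a < 13 \<Longrightarrow> b < 13 \<Longrightarrow> a = b \<and> (a < 4 \<or> i = j)"
  by (auto simp: lift_def split: if_splits) presburger+

lemma lift_ge4: "lift i a \<ge> 4 \<longleftrightarrow> a \<ge> 4"
  by (simp add: lift_def)

definition glued :: "nat \<Rightarrow> (nat \<Rightarrow> nat set set) \<Rightarrow> nat set set" where
  "glued k B = (\<Union>i\<le>k. (`) (lift i) ` B i)"

lemma gluedE:
  assumes "e \<in> glued k B"
  obtains i x where "i \<le> k" "x \<in> B i" "e = lift i ` x"
  using assms by (auto simp: glued_def)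

lemma inj_on_lift: "x \<subseteq> {..<13} \<Longrightarrow> inj_on (lift i) x"
  by (rule inj_onI) (use lift_eqD in blast)

lemma glued_one_infinite:
  assumes B: "\<And>i. block 13 (B i)"
    and e: "e \<in> glued k B" "u \<in> e" "v \<in> e" "u < 4" "v < 4"
  shows "u = v"
proof -
  obtain i x where x: "x \<in> B i" "e = lift i ` x" using e(1) by (rule gluedE)
  obtain a b where "a \<in> x" "b \<in> x" "u = lift i a" "v = lift i b" using x e by auto
  moreover from this have "a < 4" "b < 4" using e lift_ge4 by (metis not_less)+
  ultimately show ?thesis using B[of i] x unfolding block_def by metis
qed

lemma glued_same_block:
  assumes B: "\<And>i. block 13 (B i)"
    and e: "e \<in> glued k B" "f \<in> glued k B" "u \<in> e" "u \<in> f" "u \<ge> 4"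
  obtains i x y where "x \<in> B i" "y \<in> B i" "e = lift i ` x" "f = lift i ` y"
proof -
  obtain i x where x: "x \<in> B i" "e = lift i ` x" using e(1) by (rule gluedE)
  obtain j y where y: "y \<in> B j" "f = lift j ` y" using e(2) by (rule gluedE)
  have lt: "x \<subseteq> {..<13}" "y \<subseteq> {..<13}" using B x y unfolding block_def by blast+
  obtain a b where ab: "a \<in> x" "b \<in> y" "u = lift i a" "u = lift j b" using e x y by auto
  then have "a < 13" "b < 13" using lt by auto
  then have "i = j" using lift_eqD[of i a j b] ab e lift_ge4[of i a] by auto
  then show ?thesis using that x y by blast
qed

text \<open>Affine points belong to one block only, so \<open>f\<close> and \<open>g\<close> lie in the block of \<open>e\<close>, where any two
edges meet.\<close>

lemma glued_meet:
  assumes B: "\<And>i. block 13 (B i)"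
    and e: "e \<in> glued k B" "f \<in> glued k B" "g \<in> glued k B"
    and u: "u \<in> e" "u \<in> f" "u \<ge> 4" and v: "v \<in> e" "v \<in> g" "v \<ge> 4"
  shows "f \<inter> g \<noteq> {}"
proof -
  obtain i x y where 1: "x \<in> B i" "y \<in> B i" "e = lift i ` x" "f = lift i ` y"
    using glued_same_block[OF B e(1,2) u] .
  obtain j x' z where 2: "x' \<in> B j" "z \<in> B j" "e = lift j ` x'" "g = lift j ` z"
    using glued_same_block[OF B e(1,3) v] .
  have lt: "x \<subseteq> {..<13}" "x' \<subseteq> {..<13}" using B 1 2 unfolding block_def by blast+
  have "u \<in> lift i ` x" "u \<in> lift j ` x'" using u 1(3) 2(3) by simp_all
  then obtain a b where ab: "a \<in> x" "b \<in> x'" "u = lift i a" "u = lift j b" by blast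
  then have "a < 13" "b < 13" using lt by auto
  then have "i = j" using lift_eqD[of i a j b] ab u lift_ge4[of i a] by auto
  show ?thesis
  proof (cases "y = z")
    case True
    then show ?thesis using 1 2 u \<open>i = j\<close> by auto
  next
    case False
    then have "is_singleton (y \<inter> z)" using B[of i] 1 2 \<open>i = j\<close> unfolding block_def by blast
    then obtain p where "p \<in> y" "p \<in> z" by (auto simp: is_singleton_def)
    then show ?thesis using 1 2 \<open>i = j\<close> by auto
  qed
qed

lemma glued_linear:
  assumes B: "\<And>i. block 13 (B i)"
    and e: "e \<in> glued k B" "f \<in> glued k B" and uv: "u \<in> e" "u \<in> f" "v \<in> e" "v \<in> f" "u \<noteq> v"
  shows "e = f"
proof -
  have "u \<ge> 4 \<or> v \<ge> 4" using glued_one_infinite[OF B e(1) uv(1,3)] uv(5) by linarith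
  then obtain i x y where 1: "x \<in> B i" "y \<in> B i" "e = lift i ` x" "f = lift i ` y"
    using glued_same_block[OF B e uv(1,2)] glued_same_block[OF B e uv(3,4)] by metis
  have lt: "x \<subseteq> {..<13}" "y \<subseteq> {..<13}" using B 1 unfolding block_def by blast+
  have common: "\<exists>a. a \<in> x \<inter> y \<and> w = lift i a" if w: "w \<in> e" "w \<in> f" for w
  proof -
    obtain a b where ab: "a \<in> x" "b \<in> y" "w = lift i a" "w = lift i b" using w 1 by auto
    then have "a < 13" "b < 13" using lt by auto
    then show ?thesis using lift_eqD[of i a i b] ab by auto
  qed
  obtain a b where ab: "a \<in> x \<inter> y" "b \<in> x \<inter> y" "u = lift i a" "v = lift i b"
    using common uv by metis
  have "\<not> is_singleton (x \<inter> y)"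
  proof
    assume "is_singleton (x \<inter> y)"
    then obtain p where "x \<inter> y = {p}" by (auto simp: is_singleton_def)
    then have "a = b" using ab(1,2) by (metis singletonD)
    then show False using ab(3,4) uv(5) by simp
  qed
  then have "x = y" using B[of i] 1 unfolding block_def by blast
  then show ?thesis using 1 by simp
qed

lemma card_glued:
  assumes B: "\<And>i. block 13 (B i)" and fin: "\<And>i. finite (B i)"
  shows "card (glued k B) = (\<Sum>i\<le>k. card (B i))"
proof -
  have "card (glued k B) = (\<Sum>i\<le>k. card ((`) (lift i) ` B i))"
    unfolding glued_def
  proof (rule card_UN_disjoint)
    show "\<forall>i\<in>{..k}. \<forall>j\<in>{..k}. i \<noteq> j \<longrightarrow> (`) (lift i) ` B i \<inter> (`) (lift j) ` B j = {}"
    proof (intro ballI impI, rule ccontr)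
      fix i j assume "i \<noteq> j" and "(`) (lift i) ` B i \<inter> (`) (lift j) ` B j \<noteq> {}"
      then obtain x y where x: "x \<in> B i" and y: "y \<in> B j" and eq: "lift i ` x = lift j ` y"
        by blast
      have bx: "card x = 4" "x \<subseteq> {..<13}" "\<forall>u\<in>x. \<forall>v\<in>x. u < 4 \<longrightarrow> v < 4 \<longrightarrow> u = v"
        and by': "y \<subseteq> {..<13}"
        using B x y unfolding block_def by blast+
      have "\<exists>a\<in>x. a \<ge> 4"
      proof (rule ccontr)
        assume "\<not> ?thesis"
        then have "\<forall>u\<in>x. \<forall>v\<in>x. u = v" using bx(3) by (meson not_le)
        then have "card x \<le> Suc 0" by (intro card_le_Suc0_iff_eq[THEN iffD2] card_ge_0_finite) (use bx in auto)
        then show False using bx by simp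
      qed
      then obtain a where a: "a \<in> x" "a \<ge> 4" by blast
      then obtain b where b: "b \<in> y" "lift i a = lift j b" using eq by (metis imageE imageI)
      have "a < 13" "b < 13" using a b bx by' by auto
      then show False using lift_eqD[OF b(2)] a \<open>i \<noteq> j\<close> by simp
    qed
  qed (use fin in auto)
  also have "\<dots> = (\<Sum>i\<le>k. card (B i))"
  proof (intro sum.cong refl card_image inj_onI)
    fix i x y assume "x \<in> B i" "y \<in> B i" and eq: "lift i ` x = lift i ` y"
    then have "x \<subseteq> {..<13}" "y \<subseteq> {..<13}" using B unfolding block_def by blast+
    then show "x = y"
      using inj_on_image_eq_iff[OF inj_on_lift[of "{..<13}" i], of x y] eq by simp
  qed
  finally show ?thesis .
qed

lemma glued_edges:
  assumes B: "\<And>i. block 13 (B i)" and last: "block (4 + r) (B k)" "r < 9"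
    and e: "e \<in> glued k B"
  shows "card e = 4" "e \<subseteq> {..<4 + 9 * k + r}"
proof -
  obtain i x where x: "i \<le> k" "x \<in> B i" "e = lift i ` x" using e by (rule gluedE)
  have bx: "card x = 4" "x \<subseteq> {..<13}" using B x unfolding block_def by blast+
  show "card e = 4" using x bx card_image[OF inj_on_lift[OF bx(2)]] by simp
  show "e \<subseteq> {..<4 + 9 * k + r}"
  proof (cases "i = k")
    case True
    then have "x \<subseteq> {..<4 + r}" using last x unfolding block_def by blast
    then show ?thesis using x True by (auto simp: lift_def)
  next
    case False
    then have "9 * i + 9 \<le> 9 * k" using x by simp
    then show ?thesis using x bx by (fastforce simp: lift_def)
  qed
qed

lemma ex_lin4_ge:
  fixes G :: "nat hypergraph"
  assumes "four_uniform G" "linear_hypergraph G" "card (verts G) = n" "free_of F G"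
  shows "card (edges G) \<le> ex_lin4 n F"
  unfolding ex_lin4_def
proof (rule Max_ge)
  let ?C = "{card (edges G) | G :: nat hypergraph.
            four_uniform G \<and> linear_hypergraph G \<and> card (verts G) = n \<and> free_of F G}"
  have "?C \<subseteq> {..2 ^ n}"
  proof
    fix m assume "m \<in> ?C"
    then obtain G :: "nat hypergraph" where G: "m = card (edges G)" "four_uniform G" "card (verts G) = n"
      by blast
    then have "finite (verts G)" "edges G \<subseteq> Pow (verts G)" by (auto simp: four_uniform_def)
    then show "m \<in> {..2 ^ n}" using G card_mono[of "Pow (verts G)" "edges G"] by (simp add: card_Pow)
  qed
  then show "finite ?C" by (rule finite_subset) simp
  show "card (edges G) \<in> ?C" using assms by blast
qed

text \<open>Two of three distinct points of an edge \<open>e\<close> are affine, so two of three edges through them lie in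
the block of \<open>e\<close> and meet: there are no three disjoint edges that all meet \<open>e\<close>.\<close>

theorem ex_lin4_E4_plus_ge:
  assumes r: "r < 9"
  shows "12 * k + card (partial_block r) \<le> ex_lin4 (4 + 9 * k + r) E4_plus"
proof -
  define B where "B i = (if i < k then plane_lines else partial_block r)" for i
  have "block 13 (partial_block r)"
    using block_partial[OF r] r unfolding block_def by force
  then have B: "block 13 (B i)" for i using block_plane_lines by (simp add: B_def)
  have last: "block (4 + r) (B k)" using block_partial[OF r] by (simp add: B_def)
  have fin: "finite (B i)" for i by (simp add: B_def plane_lines_def partial_block_def)
  define G where "G = \<lparr>verts = {..<4 + 9 * k + r}, edges = glued k B\<rparr>"
  have "four_uniform G"
    using glued_edges[where B=B and k=k, OF B last r] by (simp add: four_uniform_def G_def)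
  moreover have "linear_hypergraph G"
    unfolding linear_hypergraph_def
  proof (intro ballI impI)
    fix x y e f
    assume "x \<noteq> y" "e \<in> edges G" "f \<in> edges G" "{x, y} \<subseteq> e \<and> {x, y} \<subseteq> f"
    then show "e = f" using glued_linear[where B=B, OF B, of e k f x y] by (simp add: G_def)
  qed
  moreover have "free_of E4_plus G"
  proof (rule free_of_E4_plusI)
    fix e f g h p q r
    assume E: "e \<in> edges G" "f \<in> edges G" "g \<in> edges G" "h \<in> edges G"
      and m: "p \<in> e" "q \<in> e" "r \<in> e" "p \<in> f" "q \<in> g" "r \<in> h"
      and d: "f \<inter> g = {}" "f \<inter> h = {}" "g \<inter> h = {}"
    have gl: "e \<in> glued k B" "f \<in> glued k B" "g \<in> glued k B" "h \<in> glued k B"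
      using E by (simp_all add: G_def)
    have ne: "p \<noteq> q" "p \<noteq> r" "q \<noteq> r" using m d by auto
    have "\<not> (p \<ge> 4 \<and> q \<ge> 4)" using glued_meet[where B=B, OF B gl(1,2,3) m(1,4) _ m(2,5)] d by blast
    moreover have "\<not> (p \<ge> 4 \<and> r \<ge> 4)" using glued_meet[where B=B, OF B gl(1,2,4) m(1,4) _ m(3,6)] d by blast
    moreover have "\<not> (q \<ge> 4 \<and> r \<ge> 4)" using glued_meet[where B=B, OF B gl(1,3,4) m(2,5) _ m(3,6)] d by blast
    moreover have "\<not> (p < 4 \<and> q < 4)" using glued_one_infinite[where B=B, OF B gl(1) m(1,2)] ne by blast
    moreover have "\<not> (p < 4 \<and> r < 4)" using glued_one_infinite[where B=B, OF B gl(1) m(1,3)] ne by blast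
    moreover have "\<not> (q < 4 \<and> r < 4)" using glued_one_infinite[where B=B, OF B gl(1) m(2,3)] ne by blast
    ultimately show False by linarith
  qed
  ultimately have "card (edges G) \<le> ex_lin4 (4 + 9 * k + r) E4_plus"
    by (intro ex_lin4_ge) (simp_all add: G_def)
  moreover have "card (edges G) = 12 * k + card (partial_block r)"
  proof -
    have "card (edges G) = (\<Sum>i\<le>k. card (B i))"
      using card_glued[where B=B, OF B fin] by (simp add: G_def)
    also have "\<dots> = (\<Sum>i<k. card (B i)) + card (B k)"
      by (simp add: lessThan_Suc_atMost[symmetric])
    also have "(\<Sum>i<k. card (B i)) = (\<Sum>i<k. 12)"
      by (intro sum.cong) (simp_all add: B_def card_plane_lines)
    finally show ?thesis by (simp add: B_def)
  qed
  ultimately show ?thesis by simp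
qed

section \<open>Inequalities between means\<close>

lemma inverse_sum2:
  fixes x y s :: real
  assumes "x > 0" "y > 0" "x + y \<le> s"
  shows "4 / s \<le> 1 / x + 1 / y"
proof -
  have "4 / s \<le> 4 / (x + y)" using assms by (intro divide_left_mono) auto
  also have "\<dots> \<le> 1 / x + 1 / y"
  proof -
    have "1 / x + 1 / y - 4 / (x + y) = (x - y)\<^sup>2 / (x * y * (x + y))"
      using assms by (simp add: field_simps power2_eq_square)
    also have "\<dots> \<ge> 0" using assms by simp
    finally show ?thesis by simp
  qed
  finally show ?thesis .
qed

lemma inverse_sum3:
  fixes x y z :: real
  assumes "x > 0" "y > 0" "z > 0" "x + y + z \<le> 14"
  shows "9 / 14 \<le> 1 / x + 1 / y + 1 / z"
proof -
  \<comment> \<open>the tangent of \<open>1 / t\<close> at the mean \<open>t = 14 / 3\<close> of three numbers with sum \<open>14\<close>\<close>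
  have tangent: "1 / t \<ge> 3 / 7 - 9 / 196 * t" if "t > 0" for t :: real
  proof -
    have "1 / t - (3 / 7 - 9 / 196 * t) = (3 * t / 14 - 1)\<^sup>2 / t"
      using that by (simp add: field_simps power2_eq_square)
    also have "\<dots> \<ge> 0" using that by simp
    finally show ?thesis by simp
  qed
  have "9 / 14 \<le> 9 / 7 - 9 / 196 * (x + y + z)" using assms by simp
  also have "\<dots> = (3 / 7 - 9 / 196 * x) + (3 / 7 - 9 / 196 * y) + (3 / 7 - 9 / 196 * z)"
    by (simp add: algebra_simps)
  also have "\<dots> \<le> 1 / x + 1 / y + 1 / z" using tangent assms by (intro add_mono) auto
  finally show ?thesis .
qed

section \<open>Intersection patterns of stars\<close>

text \<open>The edge set is all that the upper bound needs to know about the hypergraph; \<open>free\<close> is its freeness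
from \<open>E4_plus\<close> in the form of \<open>free_of_E4_plusD\<close>.\<close>

locale E4_plus_free =
  fixes E :: "'a set set"
  assumes finE: "finite E"
    and card4: "e \<in> E \<Longrightarrow> card e = 4"
    and lin: "\<lbrakk>e \<in> E; f \<in> E; x \<in> e; x \<in> f; y \<in> e; y \<in> f; x \<noteq> y\<rbrakk> \<Longrightarrow> e = f"
    and free: "\<lbrakk>e \<in> E; f \<in> E; g \<in> E; h \<in> E; p \<in> e; q \<in> e; r \<in> e; p \<in> f; q \<in> g; r \<in> h;
       f \<inter> g = {}; f \<inter> h = {}; g \<inter> h = {}\<rbrakk> \<Longrightarrow> False"
begin

definition deg :: "'a \<Rightarrow> nat" where
  "deg v = card {e \<in> E. v \<in> e}"

definition star :: "'a set \<Rightarrow> 'a \<Rightarrow> 'a set set" where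
  "star e v = {g \<in> E. v \<in> g \<and> g \<noteq> e}"

definition meeting :: "'a set \<Rightarrow> 'a \<Rightarrow> 'a set \<Rightarrow> 'a set set" where
  "meeting e v f = {g \<in> star e v. g \<inter> f \<noteq> {}}"

lemma fin_edge: "e \<in> E \<Longrightarrow> finite e"
  using card4 card.infinite by fastforce

lemma finite_star [simp]: "finite (star e v)" and finite_meeting [simp]: "finite (meeting e v f)"
  using finE by (auto simp: star_def meeting_def)

lemma meeting_subset: "meeting e v f \<subseteq> star e v"
  by (auto simp: meeting_def)

lemma starD: "g \<in> star e v \<Longrightarrow> g \<in> E \<and> v \<in> g \<and> g \<noteq> e"
  by (simp add: star_def)

lemma deg_pos: "e \<in> E \<Longrightarrow> v \<in> e \<Longrightarrow> deg v \<ge> 1"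
proof -
  assume "e \<in> E" "v \<in> e"
  then have "{e \<in> E. v \<in> e} \<noteq> {}" by auto
  then show ?thesis
    using finE unfolding deg_def by (simp add: card_gt_0_iff Suc_le_eq)
qed

lemma deg_star: assumes "e \<in> E" "v \<in> e" shows "deg v = Suc (card (star e v))"
proof -
  have "{g \<in> E. v \<in> g} = insert e (star e v)" "e \<notin> star e v"
    using assms by (auto simp: star_def)
  then show ?thesis by (simp add: deg_def)
qed

lemma star_avoids:
  assumes "e \<in> E" "p \<in> e" "q \<in> e" "p \<noteq> q" "f \<in> star e p"
  shows "q \<notin> f"
  using lin[of e f p q] assms by (auto simp: star_def)

text \<open>Edges through \<open>q\<close> are disjoint apart from \<open>q\<close>, so they use up different points of \<open>X\<close>.\<close>

lemma card_edges_meeting: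
  assumes "finite X" "q \<notin> X"
  shows "card {g \<in> E. q \<in> g \<and> g \<inter> X \<noteq> {}} \<le> card X"
proof (rule card_inj_on_le)
  let ?S = "{g \<in> E. q \<in> g \<and> g \<inter> X \<noteq> {}}"
  define u where "u g = (SOME y. y \<in> g \<inter> X)" for g
  have u: "u g \<in> g \<inter> X" if "g \<in> ?S" for g
    unfolding u_def by (rule someI_ex) (use that in auto)
  show "inj_on u ?S"
  proof (rule inj_onI)
    fix g h assume "g \<in> ?S" "h \<in> ?S" "u g = u h"
    then show "g = h" using u[of g] u[of h] assms(2) lin[of g h q "u g"] by auto
  qed
  show "u ` ?S \<subseteq> X" using u by auto
qed (use assms in auto)

lemma card_meeting_le:
  assumes "e \<in> E" "p \<in> e" "q \<in> e" "p \<noteq> q" "f \<in> star e p"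
  shows "card (meeting e q f) \<le> 3"
proof -
  have f: "f \<in> E" "p \<in> f" "finite f" "card f = 4"
    using assms fin_edge card4 by (auto simp: star_def)
  have "meeting e q f \<subseteq> {g \<in> E. q \<in> g \<and> g \<inter> (f - {p}) \<noteq> {}}"
    using star_avoids[of e q p] assms by (auto simp: meeting_def star_def)
  then have "card (meeting e q f) \<le> card {g \<in> E. q \<in> g \<and> g \<inter> (f - {p}) \<noteq> {}}"
    using finE by (intro card_mono) auto
  also have "\<dots> \<le> card (f - {p})"
    using f star_avoids[OF assms] by (intro card_edges_meeting) auto
  finally show ?thesis using f by simp
qed

lemma star_free:
  assumes "e \<in> E" "p \<in> e" "q \<in> e" "r \<in> e"
    and "f \<in> star e p" "g \<in> star e q" "h \<in> star e r"
    and "f \<inter> g = {}" "f \<inter> h = {}"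
  shows "g \<inter> h \<noteq> {}"
  using free[of e f g h p q r] assms by (auto simp: star_def)

text \<open>Pick an edge through \<open>p\<close>. It blocks at most three of the at least four further edges through
\<open>q\<close>, and it and the edge then picked at \<open>q\<close> block at most six of the at least seven at \<open>r\<close>.\<close>

lemma greedy:
  assumes "e \<in> E" "p \<in> e" "q \<in> e" "r \<in> e" "p \<noteq> q" "p \<noteq> r" "q \<noteq> r"
    and "deg p \<ge> 2" "deg q \<ge> 5" "deg r \<ge> 8"
  shows False
proof -
  have "card (star e p) \<ge> 1" "card (star e q) \<ge> 4" "card (star e r) \<ge> 7"
    using assms deg_star[of e p] deg_star[of e q] deg_star[of e r] by auto
  then obtain f where f: "f \<in> star e p" by (metis card.empty ex_in_conv not_one_le_zero)
  have "card (meeting e q f) \<le> 3" using card_meeting_le assms f by simp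
  then have "meeting e q f \<noteq> star e q" using \<open>card (star e q) \<ge> 4\<close> by auto
  then obtain g where g: "g \<in> star e q" "g \<inter> f = {}" by (auto simp: meeting_def)
  have "card (meeting e r f \<union> meeting e r g) \<le> 3 + 3"
    using card_meeting_le[of e p r f] card_meeting_le[of e q r g] assms f g
    by (intro card_Un_le[THEN order_trans]) auto
  then have "meeting e r f \<union> meeting e r g \<noteq> star e r" using \<open>card (star e r) \<ge> 7\<close> by auto
  then obtain h where h: "h \<in> star e r" "h \<inter> f = {}" "h \<inter> g = {}" by (auto simp: meeting_def)
  show False using star_free[of e p q r f g h] f g h assms by (auto simp: Int_commute)
qed

text \<open>Every edge at \<open>q\<close> must be met by \<open>f\<close> or by \<open>h\<close>, and each of these can meet only three of the
six. So there is no slack: the two sets of three partition the star of \<open>q\<close>.\<close>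

lemma meeting_complementary:
  assumes "e \<in> E" "p \<in> e" "q \<in> e" "r \<in> e" "p \<noteq> q" "p \<noteq> r" "q \<noteq> r"
    and "card (star e q) = 6" "f \<in> star e p" "h \<in> star e r" "f \<inter> h = {}"
  shows "card (meeting e q f) = 3" "meeting e q h = star e q - meeting e q f"
proof -
  have cov: "meeting e q f \<union> meeting e q h = star e q"
    using star_free[of e p r q f h] assms by (auto simp: meeting_def Int_commute)
  have le: "card (meeting e q f) \<le> 3" "card (meeting e q h) \<le> 3"
    using card_meeting_le[of e p q f] card_meeting_le[of e r q h] assms by auto
  have "card (meeting e q f \<union> meeting e q h) + card (meeting e q f \<inter> meeting e q h) = card (meeting e q f) + card (meeting e q h)"
    by (intro card_Un_Int[symmetric]) auto
  then have *: "card (meeting e q f \<inter> meeting e q h) = 0" "card (meeting e q f) = 3"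
    using le unfolding cov assms(8) by linarith+
  then show "card (meeting e q f) = 3" by simp
  have "meeting e q f \<inter> meeting e q h = {}" using * by simp
  then show "meeting e q h = star e q - meeting e q f" using cov by blast
qed

text \<open>The intersection pattern between the stars of \<open>a\<close> and \<open>b\<close> is two disjoint copies of \<open>K\<^sub>3\<^sub>,\<^sub>3\<close>.
In each half the three edges at \<open>a\<close> are the rows, and the three at \<open>b\<close> the columns, of a
\<open>3 \<times> 3\<close> grid of points.\<close>

definition halves where
  "halves e a b A1 A2 B1 B2 \<longleftrightarrow>
     star e a = A1 \<union> A2 \<and> A1 \<inter> A2 = {} \<and> star e b = B1 \<union> B2 \<and> B1 \<inter> B2 = {} \<and>
     card A1 = 3 \<and> card A2 = 3 \<and> card B1 = 3 \<and> card B2 = 3 \<and>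
     (\<forall>f\<in>A1. meeting e b f = B1) \<and> (\<forall>f\<in>A2. meeting e b f = B2) \<and>
     (\<forall>g\<in>B1. meeting e a g = A1) \<and> (\<forall>g\<in>B2. meeting e a g = A2)"

lemma halves_swap: "halves e a b A1 A2 B1 B2 \<Longrightarrow> halves e a b A2 A1 B2 B1"
  by (auto simp: halves_def)

lemma meeting_sym: "f \<in> star e p \<Longrightarrow> g \<in> star e q \<Longrightarrow> f \<in> meeting e p g \<longleftrightarrow> g \<in> meeting e q f"
  by (auto simp: meeting_def)

lemma ex_disjoint:
  assumes "e \<in> E" "p \<in> e" "q \<in> e" "p \<noteq> q" "f \<in> star e p" "card (star e q) \<ge> 4"
  shows "\<exists>h\<in>star e q. f \<inter> h = {}"
proof -
  have "card (meeting e q f) \<le> 3" using card_meeting_le assms by simp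
  then have "meeting e q f \<noteq> star e q" using assms by auto
  then show ?thesis by (auto simp: meeting_def)
qed

text \<open>An edge \<open>h\<close> at \<open>c\<close> singles out the edges \<open>A1\<close> at \<open>a\<close> and \<open>B1\<close> at \<open>b\<close> that meet it. The edges
at \<open>a\<close> that miss \<open>h\<close> all meet exactly the complement of \<open>B1\<close>, and symmetrically for \<open>b\<close>; since
every edge at \<open>a\<close> meets exactly three at \<open>b\<close>, none is left over to join the two halves.
Four edges at \<open>c\<close> ensure that each edge at \<open>a\<close> or \<open>b\<close> misses one of them.\<close>

lemma ex_halves:
  assumes e: "e \<in> E" "a \<in> e" "b \<in> e" "c \<in> e" "a \<noteq> b" "a \<noteq> c" "b \<noteq> c"
    and A: "card (star e a) = 6" and B: "card (star e b) = 6" and C: "card (star e c) \<ge> 4"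
  shows "\<exists>A1 A2 B1 B2. halves e a b A1 A2 B1 B2"
proof -
  have ba: "b \<noteq> a" using e by simp
  have Af: "card (meeting e b f) = 3" if f: "f \<in> star e a" for f
  proof -
    obtain h where "h \<in> star e c" "f \<inter> h = {}"
      using ex_disjoint[OF e(1,2,4,6) f C] by (elim bexE)
    then show ?thesis using meeting_complementary(1)[OF e B f] by simp
  qed
  have Bg: "card (meeting e a g) = 3" if g: "g \<in> star e b" for g
  proof -
    obtain h where "h \<in> star e c" "g \<inter> h = {}"
      using ex_disjoint[OF e(1,3,4,7) g C] by (elim bexE)
    then show ?thesis using meeting_complementary(1)[OF e(1,3,2,4) ba e(7,6) A g] by simp
  qed
  have "star e c \<noteq> {}" using C by auto
  then obtain h where h: "h \<in> star e c" by auto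
  define A1 where "A1 = meeting e a h"
  define A2 where "A2 = star e a - A1"
  define B1 where "B1 = meeting e b h"
  define B2 where "B2 = star e b - B1"
  have sub: "A1 \<subseteq> star e a" "B1 \<subseteq> star e b"
    by (simp_all add: A1_def B1_def meeting_subset)
  have A2: "meeting e b f = B2" if "f \<in> A2" for f
  proof -
    have f: "f \<in> star e a" "f \<inter> h = {}" using that by (auto simp: A2_def A1_def meeting_def)
    then have "B1 = star e b - meeting e b f"
      using meeting_complementary(2)[OF e B f(1) h f(2)] by (simp add: B1_def)
    then show ?thesis using meeting_subset[of e b f] by (simp add: B2_def double_diff)
  qed
  have B2: "meeting e a g = A2" if "g \<in> B2" for g
  proof -
    have g: "g \<in> star e b" "g \<inter> h = {}" using that by (auto simp: B2_def B1_def meeting_def)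
    then have "A1 = star e a - meeting e a g"
      using meeting_complementary(2)[OF e(1,3,2,4) ba e(7,6) A g(1) h g(2)] by (simp add: A1_def)
    then show ?thesis using meeting_subset[of e a g] by (simp add: A2_def double_diff)
  qed
  have "card A1 \<le> 3" "card B1 \<le> 3"
    unfolding A1_def B1_def using card_meeting_le[of e c] e h by auto
  then have "A1 \<noteq> star e a" "B1 \<noteq> star e b" using A B by auto
  then obtain f g where "f \<in> A2" "g \<in> B2"
    using sub unfolding A2_def B2_def by blast
  then have c2: "card B2 = 3" "card A2 = 3"
    using A2[of f] Af[of f] B2[of g] Bg[of g] by (simp_all add: A2_def B2_def)
  have fin: "finite A1" "finite B1"
    by (auto simp: A1_def B1_def)
  have c1: "card A1 = 3" "card B1 = 3"
    using c2 sub card_mono[OF finite_star sub(1)] card_mono[OF finite_star sub(2)] A B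
    unfolding A2_def B2_def by (simp_all add: card_Diff_subset[OF fin(1)] card_Diff_subset[OF fin(2)])
  have A1: "meeting e b f = B1" if f: "f \<in> A1" for f
  proof (rule card_subset_eq[OF fin(2)])
    have fa: "f \<in> star e a" using f sub by auto
    show "meeting e b f \<subseteq> B1"
    proof
      fix g assume g: "g \<in> meeting e b f"
      then have gb: "g \<in> star e b" by (simp add: meeting_def)
      have "f \<in> meeting e a g" using meeting_sym[OF fa gb] g by simp
      then have "g \<notin> B2" using B2[of g] f by (auto simp: A2_def)
      then show "g \<in> B1" using gb by (simp add: B2_def)
    qed
    show "card (meeting e b f) = card B1" using Af[OF fa] c1 by simp
  qed
  have B1: "meeting e a g = A1" if g: "g \<in> B1" for g
  proof (rule card_subset_eq[OF fin(1)])
    have gb: "g \<in> star e b" using g sub by auto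
    show "meeting e a g \<subseteq> A1"
    proof
      fix f assume f: "f \<in> meeting e a g"
      then have fa: "f \<in> star e a" by (simp add: meeting_def)
      have "g \<in> meeting e b f" using meeting_sym[OF fa gb] f by simp
      then have "f \<notin> A2" using A2[of f] g by (auto simp: B2_def)
      then show "f \<in> A1" using fa by (simp add: A2_def)
    qed
    show "card (meeting e a g) = card A1" using Bg[OF gb] c1 by simp
  qed
  have "star e a = A1 \<union> A2" "A1 \<inter> A2 = {}" "star e b = B1 \<union> B2" "B1 \<inter> B2 = {}"
    using sub by (auto simp: A2_def B2_def)
  then have "halves e a b A1 A2 B1 B2"
    unfolding halves_def using A1 A2 B1 B2 c1 c2 by (intro conjI ballI)
  then show ?thesis by blast
qed

text \<open>A further edge at another point of \<open>e\<close> lives in one of the two grids, as a transversal of it: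
it misses some \<open>g\<close> at \<open>b\<close>, and then what it meets at \<open>a\<close> is the complement of what \<open>g\<close> meets.\<close>

lemma transversal_side:
  assumes e: "e \<in> E" "a \<in> e" "b \<in> e" "c \<in> e" "a \<noteq> b" "a \<noteq> c" "b \<noteq> c"
    and H: "halves e a b A1 A2 B1 B2" and t: "t \<in> star e c"
  shows "meeting e a t = A1 \<or> meeting e a t = A2"
proof -
  have st: "star e a = A1 \<union> A2" "star e b = B1 \<union> B2" "A1 \<inter> A2 = {}" "B1 \<inter> B2 = {}"
    and c: "card A1 = 3" "card A2 = 3" "card B1 = 3" "card B2 = 3"
    and n: "\<And>g. g \<in> B1 \<Longrightarrow> meeting e a g = A1" "\<And>g. g \<in> B2 \<Longrightarrow> meeting e a g = A2"
    using H by (simp_all add: halves_def)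
  have "finite A1" "finite A2" "finite B1" "finite B2"
    using c by (auto intro: card_ge_0_finite)
  then have A: "card (star e a) = 6" and B: "card (star e b) = 6"
    by (simp_all add: st c card_Un_disjoint)
  have ba: "b \<noteq> a" "c \<noteq> b" using e by simp_all
  obtain g where g: "g \<in> star e b" "t \<inter> g = {}"
    using ex_disjoint[OF e(1,4,3) ba(2) t] B by auto
  have "g \<inter> t = {}" using g by auto
  then have "meeting e a t = star e a - meeting e a g"
    using meeting_complementary(2)[OF e(1,3,2,4) ba(1) e(7,6) A g(1) t] by simp
  moreover have "g \<in> B1 \<or> g \<in> B2" using g st by simp
  ultimately show ?thesis using n st by auto
qed

section \<open>Degrees on the grids\<close>

text \<open>The three edges at \<open>q\<close> that meet \<open>f\<close> do so in three different points, so they exhaust \<open>f - {p}\<close>.\<close>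

lemma meeting_covers:
  assumes "e \<in> E" "p \<in> e" "q \<in> e" "p \<noteq> q" "f \<in> star e p" "card (meeting e q f) = 3"
    and x: "x \<in> f" "x \<noteq> p"
  shows "\<exists>g\<in>meeting e q f. x \<in> g"
proof -
  have f: "f \<in> E" "p \<in> f" "finite f" "card f = 4" "q \<notin> f"
    using starD[OF assms(5)] fin_edge card4 star_avoids[OF assms(1-5)] by simp_all
  define u where "u g = (SOME y. y \<in> g \<inter> f)" for g
  have u: "u g \<in> g \<inter> f" if "g \<in> meeting e q f" for g
    unfolding u_def by (rule someI_ex) (use that in \<open>auto simp: meeting_def\<close>)
  have gE: "g \<in> E \<and> q \<in> g \<and> p \<notin> g" if "g \<in> meeting e q f" for g
    using star_avoids[of e q p g] that assms by (auto simp: meeting_def star_def)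
  have "inj_on u (meeting e q f)"
  proof (rule inj_onI)
    fix g h assume gh: "g \<in> meeting e q f" "h \<in> meeting e q f" "u g = u h"
    then have "u g \<in> g" "u g \<in> h" "u g \<noteq> q" using u[of g] u[of h] f by auto
    then show "g = h" using lin[of g h "u g" q] gE gh by auto
  qed
  then have "card (u ` meeting e q f) = card (f - {p})"
    using assms f by (simp add: card_image)
  moreover have "u ` meeting e q f \<subseteq> f - {p}" using u gE by fastforce
  ultimately have "u ` meeting e q f = f - {p}" using f by (intro card_subset_eq) auto
  then have "x \<in> u ` meeting e q f" using x by simp
  then show ?thesis using u by auto
qed

lemma card_two_rows:
  assumes "e \<in> E" "a \<in> e" "r \<in> star e a" "s \<in> star e a" "r \<noteq> s"
    and "a \<notin> t" "t \<inter> r \<noteq> {}" "t \<inter> s \<noteq> {}"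
  shows "card (t \<inter> (r \<union> s - {a})) \<ge> 2"
proof -
  obtain y z where yz: "y \<in> t" "y \<in> r" "z \<in> t" "z \<in> s" using assms by auto
  have "y \<noteq> z" using lin[of r s a y] yz assms by (auto simp: star_def)
  then have "card {y, z} = 2" by simp
  moreover have "{y, z} \<subseteq> t \<inter> (r \<union> s - {a})" using yz assms by auto
  moreover have "finite (t \<inter> (r \<union> s - {a}))" using fin_edge assms by (auto simp: star_def)
  ultimately show ?thesis by (metis card_mono)
qed

text \<open>By linearity such an edge is determined by its points on \<open>r - {a}\<close> and \<open>s - {a}\<close>.\<close>

lemma card_meeting_two_rows:
  assumes "e \<in> E" "a \<in> e" "r \<in> star e a" "s \<in> star e a" "r \<noteq> s"
  shows "card {g \<in> E. a \<notin> g \<and> g \<inter> r \<noteq> {} \<and> g \<inter> s \<noteq> {}} \<le> 9" (is "card ?Z \<le> 9")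
proof -
  define u where "u w g = (SOME y. y \<in> g \<inter> w)" for w g :: "'a set"
  have u: "u w g \<in> g \<inter> w" if "g \<inter> w \<noteq> {}" for w g
    unfolding u_def by (rule someI_ex) (use that in auto)
  have rs: "r \<in> E" "a \<in> r" "s \<in> E" "a \<in> s" using assms by (auto simp: star_def)
  have fin: "finite r" "finite s" using rs fin_edge by auto
  have "card ?Z \<le> card ((r - {a}) \<times> (s - {a}))"
  proof (rule card_inj_on_le)
    show "(\<lambda>g. (u r g, u s g)) ` ?Z \<subseteq> (r - {a}) \<times> (s - {a})"
    proof (rule image_subsetI)
      fix g assume "g \<in> ?Z"
      then show "(u r g, u s g) \<in> (r - {a}) \<times> (s - {a})" using u[of g r] u[of g s] by auto
    qed
    show "inj_on (\<lambda>g. (u r g, u s g)) ?Z"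
    proof (rule inj_onI)
      fix g h assume g: "g \<in> ?Z" and h: "h \<in> ?Z" and eq: "(u r g, u s g) = (u r h, u s h)"
      have *: "u r g \<in> g" "u r g \<in> r" "u s g \<in> g" "u s g \<in> s" "u r g \<in> h" "u s g \<in> h"
        using u[of g r] u[of g s] u[of h r] u[of h s] g h eq by auto
      have "u r g \<noteq> a" using * g by auto
      then have "u r g \<noteq> u s g" using lin[OF rs(1,3,2,4) *(2)] *(4) assms(5) by metis
      then show "g = h" using lin[of g h "u r g" "u s g"] * g h by auto
    qed
  qed (use fin in auto)
  also have "\<dots> = 9" using rs fin card4 by (simp add: card_cartesian_product)
  finally show ?thesis .
qed

text \<open>An edge \<open>g\<close> that meets the grid of \<open>A1\<close> only in the row of its point \<open>x\<close> is disjoint from the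
column \<open>q\<close> through another point \<open>y\<close> of this row. A row \<open>s\<close> of the other grid is disjoint from \<open>q\<close>
as well, so if \<open>s\<close> missed \<open>g\<close>, then \<open>s\<close>, \<open>g\<close>, \<open>q\<close> would be three disjoint edges meeting \<open>f\<close>.\<close>

lemma lone_meets_other_half:
  assumes e: "e \<in> E" "a \<in> e" "b \<in> e" "a \<noteq> b"
    and H: "halves e a b A1 A2 B1 B2"
    and f: "f \<in> A1" "x \<in> f" "x \<noteq> a"
    and g: "g \<in> E" "x \<in> g" "a \<notin> g" "\<forall>r\<in>A1 - {f}. g \<inter> r = {}"
    and s: "s \<in> A2"
  shows "g \<inter> s \<noteq> {}"
proof
  assume gs: "g \<inter> s = {}"
  have st: "star e a = A1 \<union> A2" "star e b = B1 \<union> B2" "A1 \<inter> A2 = {}" "B1 \<inter> B2 = {}"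
    and c: "card A1 = 3" "card B1 = 3"
    and n: "meeting e b f = B1" "meeting e b s = B2" "\<And>q. q \<in> B1 \<Longrightarrow> meeting e a q = A1"
    using H f s by (simp_all add: halves_def)
  have fE: "f \<in> E" "a \<in> f" "f \<in> star e a" "s \<in> star e a" "s \<in> E" "a \<in> s"
    using st f s by (auto simp: star_def)
  have "card (f - {a, x}) \<noteq> 0" using card4[OF fE(1)] f fE by (simp add: card_Diff_subset)
  then have "f - {a, x} \<noteq> {}" by (metis card.empty)
  then obtain y where y: "y \<in> f" "y \<noteq> a" "y \<noteq> x" by auto
  obtain q where q: "q \<in> B1" "y \<in> q"
    using meeting_covers[OF e(1,2,3,4) fE(3) _ y(1,2)] n c by auto
  have qb: "q \<in> star e b" using q st by auto
  then have qE: "q \<in> E" "b \<in> q" "a \<notin> q" using star_avoids[of e b a q] e by (auto simp: star_def)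
  have qf: "q \<inter> f \<subseteq> {y}" using lin[of q f y] q y qE fE by auto
  have bq: "z = b \<or> z \<in> f \<or> (\<exists>r\<in>A1 - {f}. z \<in> r)" if z: "z \<in> q" for z
  proof (cases "z = b")
    case False
    then obtain r where "r \<in> A1" "z \<in> r"
      using meeting_covers[OF e(1,3,2) e(4)[symmetric] qb _ z] n(3)[OF q(1)] c by auto
    then show ?thesis by auto
  qed simp
  have "b \<notin> g"
  proof
    assume "b \<in> g"
    moreover have "x \<notin> e" using lin[of e f x a] e f fE by (auto simp: star_def)
    ultimately have "g \<in> star e b" using g by (auto simp: star_def)
    then have "g \<in> meeting e b f" using f g by (auto simp: meeting_def)
    then have ng: "meeting e a g = A1" using n by auto
    have "card (A1 - {f}) \<noteq> 0" using c f by simp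
    then have "A1 - {f} \<noteq> {}" by (metis card.empty)
    then obtain r where r: "r \<in> A1 - {f}" by auto
    then have "r \<in> meeting e a g" "g \<inter> r = {}" using ng bspec[OF g(4) r] by simp_all
    then show False by (auto simp: meeting_def)
  qed
  moreover have "y \<notin> g" using lin[of f g x y] y g f fE by auto
  ultimately have qg: "g \<inter> q = {}" using bq qf g by blast
  have "q \<notin> meeting e b s" using q(1) n(2) st(4) by auto
  then have "s \<inter> q = {}" using qb by (auto simp: meeting_def)
  then show False
    using free[OF fE(1) g(1) fE(5) qE(1) f(2) fE(2) y(1) g(2) fE(6) q(2) gs qg] by simp
qed

text \<open>Count the edges through the points \<open>x\<close> of a row \<open>f\<close> of the first grid. Write \<open>T A1\<close>, \<open>T A2\<close> for the
edges at \<open>c\<close> or \<open>d\<close> in the first and the second grid, \<open>k x\<close> for the number of members of \<open>T A1\<close>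
through \<open>x\<close>, and \<open>L x\<close> for the edges through \<open>x\<close> that avoid the other two rows. The other two rows
have six points; the column through \<open>x\<close> and the \<open>k x\<close> transversals take two each, and every other
edge through \<open>x\<close> outside \<open>L x\<close> takes at least one, so \<open>deg x + k x \<le> 6 + card (L x)\<close>. The sets \<open>L x\<close>
compete with the three columns and with \<open>T A2\<close> for the nine pairs of points on two rows of the
second grid, so few transversals in the second grid are the price for many edges in \<open>L x\<close>. As there
are at least ten transversals in total, the two effects balance.\<close>

lemma row_degrees:
  assumes e: "e \<in> E" "a \<in> e" "b \<in> e" "c \<in> e" "d \<in> e"
    and dist: "a \<noteq> b" "a \<noteq> c" "a \<noteq> d" "b \<noteq> c" "b \<noteq> d" "c \<noteq> d"
    and H: "halves e a b A1 A2 B1 B2"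
    and CD: "card (star e c) + card (star e d) \<ge> 10"
    and f: "f \<in> A1"
  shows "\<And>x. x \<in> f - {a} \<Longrightarrow> deg x \<le> 6" and "(\<Sum>x\<in>f - {a}. deg x) \<le> 14"
proof -
  have st: "star e a = A1 \<union> A2" "star e b = B1 \<union> B2" "A1 \<inter> A2 = {}" "B1 \<inter> B2 = {}"
    and cA: "card A1 = 3" "card A2 = 3" "card B1 = 3" "card B2 = 3"
    and nA: "\<And>f. f \<in> A1 \<Longrightarrow> meeting e b f = B1" "\<And>f. f \<in> A2 \<Longrightarrow> meeting e b f = B2"
    and nB: "\<And>q. q \<in> B1 \<Longrightarrow> meeting e a q = A1" "\<And>q. q \<in> B2 \<Longrightarrow> meeting e a q = A2"
    using H by (simp_all add: halves_def)
  have fE: "f \<in> E" "a \<in> f" "f \<in> star e a" "f \<noteq> e" using st f by (auto simp: star_def)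
  have fin: "finite f" "card (f - {a}) = 3" using fE fin_edge card4 by auto
  have xe: "x \<notin> e" if "x \<in> f - {a}" for x using lin[of e f x a] e that fE by auto
  define X where "X = star e c \<union> star e d"
  have X: "t \<in> E \<and> a \<notin> t \<and> b \<notin> t \<and> (meeting e a t = A1 \<or> meeting e a t = A2)" if "t \<in> X" for t
  proof -
    have "\<exists>v\<in>{c, d}. t \<in> star e v" using that by (auto simp: X_def)
    then obtain v where v: "v \<in> {c,d}" "t \<in> star e v" by blast
    then have ve: "v \<in> e" "a \<noteq> v" "b \<noteq> v" using e dist by auto
    show ?thesis
      using transversal_side[OF e(1-3) ve(1) dist(1) ve(2,3) H v(2)] starD[OF v(2)]
        star_avoids[OF e(1) ve(1) e(2) ve(2)[symmetric] v(2)]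
        star_avoids[OF e(1) ve(1) e(3) ve(3)[symmetric] v(2)] by simp
  qed
  have "star e c \<inter> star e d = {}" using star_avoids[of e c d] e dist by (auto simp: star_def)
  then have cX: "card X \<ge> 10" using CD by (simp add: X_def card_Un_disjoint)
  have finX: "finite X" by (simp add: X_def)
  define T where "T W = {t \<in> X. meeting e a t = W}" for W
  have finT: "finite (T W)" for W using finX by (simp add: T_def)
  have "X = T A1 \<union> T A2" using X by (auto simp: T_def)
  then have cT: "card (T A1) + card (T A2) \<ge> 10"
    using cX card_Un_le[of "T A1" "T A2"] by simp
  define k where "k x = card {t \<in> T A1. x \<in> t}" for x
  define L where "L x = {g \<in> E. x \<in> g \<and> a \<notin> g \<and> (\<forall>r\<in>A1 - {f}. g \<inter> r = {})}" for x
  have finL: "finite (L x)" for x using finE by (simp add: L_def)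
  have "card (A1 - {f}) = 2" using cA f by simp
  then obtain r s where rs: "A1 - {f} = {r, s}" "r \<noteq> s" by (auto simp: card_2_iff)
  have rs': "r \<in> A1" "s \<in> A1" using rs by blast+
  then have rsE: "r \<in> star e a" "s \<in> star e a" "r \<in> E" "s \<in> E" "a \<in> r" "a \<in> s"
    using st by (auto simp: star_def)
  define R where "R = r \<union> s - {a}"
  have finR: "finite R" using rsE fin_edge by (auto simp: R_def)
  have "card R \<le> card ((r - {a}) \<union> (s - {a}))" using rsE fin_edge
    by (intro card_mono) (auto simp: R_def)
  also have "\<dots> \<le> 6" using card_Un_le[of "r - {a}" "s - {a}"] rsE fin_edge card4 by simp
  finally have cR: "card R \<le> 6" .
  have degk: "deg x + k x \<le> 6 + card (L x)" if x: "x \<in> f - {a}" for x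
  proof -
    define Q where "Q = {g \<in> E. x \<in> g \<and> a \<notin> g \<and> g \<inter> R \<noteq> {}}"
    have finQ: "finite Q" using finE by (simp add: Q_def)
    have "{g \<in> E. x \<in> g} \<subseteq> insert f (Q \<union> L x)"
    proof
      fix g assume "g \<in> {g \<in> E. x \<in> g}"
      then have g: "g \<in> E" "x \<in> g" by auto
      show "g \<in> insert f (Q \<union> L x)"
      proof (cases "a \<in> g")
        case True
        then show ?thesis using lin[of g f x a] g fE x by auto
      next
        case False
        then have "g \<in> L x" if "g \<inter> R = {}"
          using g that unfolding L_def rs(1) R_def by blast
        then show ?thesis using g False unfolding Q_def by blast
      qed
    qed
    then have "deg x \<le> card (insert f (Q \<union> L x))" unfolding deg_def using finQ finL
      by (intro card_mono) auto
    also have "\<dots> \<le> Suc (card Q + card (L x))"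
      using card_Un_le[of Q "L x"] finQ finL by (simp add: card_insert_if)
    finally have 1: "deg x \<le> Suc (card Q + card (L x))" .
    obtain q where q: "q \<in> B1" "x \<in> q"
      using meeting_covers[OF e(1-3) dist(1) fE(3)] nA(1)[OF f] cA x by auto
    define Q' where "Q' = insert q {t \<in> T A1. x \<in> t}"
    have qE: "q \<in> E" "b \<in> q" "a \<notin> q"
      using q st star_avoids[of e b a q] e dist by (auto simp: star_def)
    have "q \<notin> X" using X qE by auto
    then have cQ': "card Q' = Suc (k x)"
      using finX by (simp add: Q'_def k_def T_def)
    have nQ': "t \<in> E \<and> x \<in> t \<and> a \<notin> t \<and> meeting e a t = A1" if "t \<in> Q'" for t
      using that X nB q qE by (auto simp: Q'_def T_def)
    have two: "card (t \<inter> R) \<ge> 2" if "t \<in> Q'" for t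
      unfolding R_def
    proof (rule card_two_rows[OF e(1,2) rsE(1,2) rs(2)])
      have "r \<in> meeting e a t" "s \<in> meeting e a t" using nQ'[OF that] rs' by auto
      then show "t \<inter> r \<noteq> {}" "t \<inter> s \<noteq> {}" by (auto simp: meeting_def)
    qed (use nQ'[OF that] in auto)
    have Q'Q: "Q' \<subseteq> Q"
    proof
      fix t assume t: "t \<in> Q'"
      then have "t \<inter> R \<noteq> {}" using two[OF t] by auto
      then show "t \<in> Q" using nQ'[OF t] by (simp add: Q_def)
    qed
    have "x \<notin> R" using lin[of f r x a] lin[of f s x a] x fE rsE rs by (auto simp: R_def)
    then have disj: "g \<inter> R \<inter> (h \<inter> R) = {}" if "g \<in> Q" "h \<in> Q" "g \<noteq> h" for g h
      using lin[of g h x] that by (auto simp: Q_def)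
    have "(\<Sum>g\<in>Q. if g \<in> Q' then 1 else 0) = card Q'"
      using Q'Q finQ by (simp add: sum.If_cases Int_absorb1)
    then have "card Q + card Q' = (\<Sum>g\<in>Q. 1 + (if g \<in> Q' then 1 else 0))"
      by (subst sum.distrib) simp
    also have "\<dots> \<le> (\<Sum>g\<in>Q. card (g \<inter> R))"
    proof (rule sum_mono)
      fix g assume "g \<in> Q"
      then have "card (g \<inter> R) \<noteq> 0" using finR by (auto simp: Q_def)
      then show "1 + (if g \<in> Q' then 1 else 0) \<le> card (g \<inter> R)" using two[of g] by auto
    qed
    also have "\<dots> = card (\<Union>g\<in>Q. g \<inter> R)"
      using finQ finR disj by (intro card_UN_disjoint[symmetric]) auto
    also have "\<dots> \<le> card R" using finR by (intro card_mono) auto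
    finally show ?thesis using cR cQ' 1 by simp
  qed
  \<comment> \<open>at most one transversal through \<open>x\<close> contains \<open>c\<close>, and at most one contains \<open>d\<close>\<close>
  have k2: "k x \<le> 2" if x: "x \<in> f - {a}" for x
  proof -
    have one: "card {t \<in> star e v. x \<in> t} \<le> 1" if "v \<in> e" for v
      using lin[of _ _ x v] xe[OF x] that
      by (subst One_nat_def, intro card_le_Suc0_iff_eq[THEN iffD2]) (auto simp: star_def finE)
    have "{t \<in> T A1. x \<in> t} \<subseteq> {t \<in> star e c. x \<in> t} \<union> {t \<in> star e d. x \<in> t}"
      by (auto simp: T_def X_def)
    then have "k x \<le> card ({t \<in> star e c. x \<in> t} \<union> {t \<in> star e d. x \<in> t})"
      unfolding k_def by (intro card_mono) auto
    also have "\<dots> \<le> 1 + 1"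
      using one e by (intro card_Un_le[THEN order_trans] add_mono) auto
    finally show ?thesis by simp
  qed
  have sumk: "card (T A1) \<le> (\<Sum>x\<in>f - {a}. k x)"
  proof -
    have "T A1 \<subseteq> (\<Union>x\<in>f - {a}. {t \<in> T A1. x \<in> t})"
    proof
      fix t assume t: "t \<in> T A1"
      then have "f \<in> meeting e a t" "a \<notin> t" using f X[of t] by (simp_all add: T_def)
      then show "t \<in> (\<Union>x\<in>f - {a}. {t \<in> T A1. x \<in> t})" using t by (auto simp: meeting_def)
    qed
    then have "card (T A1) \<le> card (\<Union>x\<in>f - {a}. {t \<in> T A1. x \<in> t})"
      using fin finT by (intro card_mono) auto
    also have "\<dots> \<le> (\<Sum>x\<in>f - {a}. k x)" unfolding k_def using fin by (intro card_UN_le) auto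
    finally show ?thesis .
  qed
  have suml: "card (T A2) + (\<Sum>x\<in>f - {a}. card (L x)) \<le> 6"
  proof -
    have "\<exists>r s. r \<in> A2 \<and> s \<in> A2 \<and> r \<noteq> s"
      using cA(2) by (metis card_3_iff insertCI)
    then obtain r' s' where r's': "r' \<in> A2" "s' \<in> A2" "r' \<noteq> s'" by blast
    let ?Z = "{g \<in> E. a \<notin> g \<and> g \<inter> r' \<noteq> {} \<and> g \<inter> s' \<noteq> {}}"
    let ?L = "\<Union>x\<in>f - {a}. L x"
    have B2: "q \<in> E \<and> a \<notin> q \<and> meeting e a q = A2" if "q \<in> B2" for q
      using that st nB star_avoids[of e b a q] e dist by (auto simp: star_def)
    have nbZ: "g \<in> ?Z" if "g \<in> E" "a \<notin> g" "meeting e a g = A2" for g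
    proof -
      have "r' \<in> meeting e a g" "s' \<in> meeting e a g" using that r's' by auto
      then show ?thesis using that by (auto simp: meeting_def)
    qed
    have LZ: "?L \<subseteq> ?Z"
      using lone_meets_other_half[OF e(1-3) dist(1) H f] r's' by (auto simp: L_def)
    have notL: "g \<notin> ?L" if "meeting e a g = A2" for g
    proof
      assume "g \<in> ?L"
      then have "f \<in> meeting e a g" using fE by (auto simp: L_def meeting_def)
      then show False using that f st(3) by blast
    qed
    have sub: "B2 \<union> T A2 \<union> ?L \<subseteq> ?Z"
      using LZ B2 nbZ X unfolding T_def by blast
    have fins: "finite B2" "finite (T A2)" "finite ?L"
      using cA(4) finT finL fin by (auto intro: card_ge_0_finite)
    have "b \<in> q" if "q \<in> B2" for q using that st by (auto simp: star_def)
    then have d1: "B2 \<inter> T A2 = {}" using X unfolding T_def by blast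
    have d2: "(B2 \<union> T A2) \<inter> ?L = {}"
      using notL B2 unfolding T_def by blast
    have "L x \<inter> L y = {}" if "x \<in> f - {a}" "y \<in> f - {a}" "x \<noteq> y" for x y
    proof (rule ccontr)
      assume "L x \<inter> L y \<noteq> {}"
      then obtain g where "g \<in> E" "x \<in> g" "y \<in> g" "a \<notin> g" by (auto simp: L_def)
      then show False using lin[of f g x y] that fE by auto
    qed
    then have "card ?L = (\<Sum>x\<in>f - {a}. card (L x))"
      using fin finL by (intro card_UN_disjoint) auto
    then have "card B2 + card (T A2) + (\<Sum>x\<in>f - {a}. card (L x)) = card (B2 \<union> T A2 \<union> ?L)"
      using fins d1 d2 by (simp add: card_Un_disjoint)
    also have "\<dots> \<le> card ?Z" using sub finE by (intro card_mono) auto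
    also have "\<dots> \<le> 9"
      using card_meeting_two_rows[OF e(1,2) _ _ r's'(3)] r's' st by auto
    finally show ?thesis using cA by simp
  qed
  show "deg x \<le> 6" if x: "x \<in> f - {a}" for x
  proof -
    have finf: "finite (f - {a})" using fin by simp
    have "(\<Sum>y\<in>f - {a} - {x}. k y) \<le> (\<Sum>y\<in>f - {a} - {x}. 2)"
      using k2 by (intro sum_mono) auto
    also have "\<dots> = 4" using fin x finf by simp
    finally have "(\<Sum>y\<in>f - {a}. k y) \<le> k x + 4" using sum.remove[OF finf x, of k] by simp
    moreover have "card (L x) \<le> (\<Sum>y\<in>f - {a}. card (L y))"
      using x finf by (intro member_le_sum) auto
    ultimately show ?thesis using degk[OF x] sumk suml cT by linarith
  qed
  have "(\<Sum>x\<in>f - {a}. deg x + k x) \<le> (\<Sum>x\<in>f - {a}. 6 + card (L x))"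
    by (intro sum_mono degk)
  then have "(\<Sum>x\<in>f - {a}. deg x) + (\<Sum>x\<in>f - {a}. k x) \<le> 18 + (\<Sum>x\<in>f - {a}. card (L x))"
    using fin by (simp add: sum.distrib)
  then show "(\<Sum>x\<in>f - {a}. deg x) \<le> 14" using sumk suml cT by linarith
qed

section \<open>Discharging\<close>

text \<open>These are the edges with all degrees below \<open>8\<close> whose weight, the sum of \<open>1 / deg v\<close> over their
points, is less than \<open>9 / 14\<close>; compare \<open>4 / 14 + 1 / 5 + 1 / 7\<close> and \<open>4 / 14 + 1 / 6 + 1 / 6\<close> with
\<open>1 / 7 + 3 / 6 = 9 / 14\<close>.\<close>

definition deficient :: "'a set \<Rightarrow> bool" where
  "deficient e \<longleftrightarrow> e \<in> E \<and> (\<forall>v\<in>e. deg v < 8) \<and>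
     (\<exists>a b c d. e = {a, b, c, d} \<and> distinct [a, b, c, d] \<and>
        deg a = 7 \<and> deg b = 7 \<and> deg c + deg d \<ge> 12)"

text \<open>The point \<open>a\<close> will give its whole charge to \<open>e\<close>. The other edges through \<open>a\<close> can do without it:
three degrees with sum at most \<open>14\<close> have inverses with sum at least \<open>9 / 14\<close>. The second point of
degree \<open>7\<close> shows below that no point is asked to give twice.\<close>

lemma deficient_donor:
  assumes "deficient e"
  shows "\<exists>a. a \<in> e \<and> deg a = 7 \<and> (\<exists>b\<in>e. b \<noteq> a \<and> deg b = 7) \<and>
    (\<forall>f\<in>star e a. (\<forall>x\<in>f - {a}. deg x \<le> 6) \<and> (\<Sum>x\<in>f - {a}. deg x) \<le> 14)"
proof -
  obtain a b c d where e: "e = {a, b, c, d}" and dist: "distinct [a, b, c, d]"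
    and degs: "deg a = 7" "deg b = 7" "deg c + deg d \<ge> 12" and eE: "e \<in> E"
    and low: "\<forall>v\<in>e. deg v < 8"
    using assms unfolding deficient_def by blast
  have ne: "a \<noteq> b" "a \<noteq> c" "a \<noteq> d" "b \<noteq> c" "b \<noteq> d" "c \<noteq> d" using dist by auto
  have mem: "a \<in> e" "b \<in> e" "c \<in> e" "d \<in> e" using e by auto
  have sc: "card (star e a) = 6" "card (star e b) = 6" "card (star e c) + card (star e d) \<ge> 10"
    using degs deg_star[OF eE mem(1)] deg_star[OF eE mem(2)] deg_star[OF eE mem(3)]
      deg_star[OF eE mem(4)] by linarith+
  have "deg d \<le> 7" using low mem by fastforce
  then have "card (star e c) \<ge> 4" using sc deg_star[OF eE mem(4)] by linarith
  then obtain A1 A2 B1 B2 where H: "halves e a b A1 A2 B1 B2"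
    using ex_halves[OF eE mem(1-3) ne(1,2,4) sc(1,2)] by blast
  have rows: "\<forall>f\<in>star e a. (\<forall>x\<in>f - {a}. deg x \<le> 6) \<and> (\<Sum>x\<in>f - {a}. deg x) \<le> 14"
  proof
    fix f assume "f \<in> star e a"
    then have "f \<in> A1 \<or> f \<in> A2" using H by (simp add: halves_def)
    then show "(\<forall>x\<in>f - {a}. deg x \<le> 6) \<and> (\<Sum>x\<in>f - {a}. deg x) \<le> 14"
      using row_degrees[OF eE mem ne H sc(3)] row_degrees[OF eE mem ne halves_swap[OF H] sc(3)]
      by blast
  qed
  show ?thesis
    by (intro exI[of _ a] conjI bexI[of _ b] rows mem degs not_sym[OF ne(1)])
qed

text \<open>With at most one point of degree \<open>7\<close> the weight is at least \<open>1 / 7 + 3 / 6 = 9 / 14\<close>. With two,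
the other two degrees have sum at most \<open>11\<close>, and \<open>2 / 7 + 4 / 11 > 9 / 14\<close>.\<close>

lemma weight_not_deficient:
  assumes "e \<in> E" "\<forall>v\<in>e. deg v < 8" "\<not> deficient e"
  shows "9 / 14 \<le> (\<Sum>v\<in>e. 1 / real (deg v))"
proof -
  have fin: "finite e" "card e = 4" using assms fin_edge card4 by auto
  have pos: "deg v \<ge> 1" if "v \<in> e" for v using deg_pos assms that by simp
  show ?thesis
  proof (cases "\<exists>a\<in>e. \<exists>b\<in>e. a \<noteq> b \<and> deg a = 7 \<and> deg b = 7")
    case True
    then obtain a b where ab: "a \<in> e" "b \<in> e" "a \<noteq> b" "deg a = 7" "deg b = 7" by blast
    have "card (e - {a, b}) = 2" using fin ab by (simp add: card_Diff_subset)
    then obtain c d where cd: "e - {a, b} = {c, d}" "c \<noteq> d" by (auto simp: card_2_iff)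
    have e: "e = {a, b, c, d}" using cd ab by blast
    have "c \<in> e - {a, b}" "d \<in> e - {a, b}" using cd by auto
    then have dist: "distinct [a, b, c, d]" using cd ab by auto
    have "deg c + deg d \<le> 11"
    proof (rule ccontr)
      assume "\<not> deg c + deg d \<le> 11"
      then have "deg c + deg d \<ge> 12" by simp
      then have "deficient e" unfolding deficient_def using assms(1,2) e dist ab by blast
      then show False using assms by simp
    qed
    then have "4 / 11 \<le> 1 / real (deg c) + 1 / real (deg d)"
      using pos[of c] pos[of d] e by (intro inverse_sum2) auto
    then show ?thesis using dist ab by (simp add: e)
  next
    case False
    obtain a where a: "a \<in> e" "\<forall>v\<in>e - {a}. deg v \<noteq> 7"
    proof (cases "\<exists>a\<in>e. deg a = 7")
      case True
      then show ?thesis using that False by blast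
    next
      case False
      moreover have "e \<noteq> {}" using fin by auto
      ultimately show ?thesis using that by blast
    qed
    have "1 / 7 \<le> 1 / real (deg a)"
      using a(1) assms pos[of a] by (intro divide_left_mono) auto
    moreover have "(\<Sum>v\<in>e - {a}. 1 / 6) \<le> (\<Sum>v\<in>e - {a}. 1 / real (deg v))"
    proof (rule sum_mono)
      fix v assume v: "v \<in> e - {a}"
      then have "deg v < 8" "deg v \<noteq> 7" "deg v \<ge> 1" using assms a pos by auto
      then show "1 / 6 \<le> 1 / real (deg v)" by (intro divide_left_mono) auto
    qed
    moreover have "card (e - {a}) = 3" using fin a by simp
    ultimately show ?thesis using sum.remove[OF fin(1) a(1), of "\<lambda>v. 1 / real (deg v)"] by simp
  qed
qed

text \<open>Next to a point of degree at least \<open>8\<close>, the greedy choice leaves two possibilities: the other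
three degrees are at most \<open>4\<close>, or two of them are \<open>1\<close>.\<close>

lemma weight_high:
  assumes e: "e \<in> E" "p \<in> e" "deg p \<ge> 8"
    and S: "\<forall>v\<in>e. deg v < 8 \<longrightarrow> v \<in> W"
  shows "9 / 14 \<le> (\<Sum>v\<in>e \<inter> W. 1 / real (deg v))"
proof -
  have fin: "finite e" "card (e - {p}) = 3" using e fin_edge card4 by auto
  have pos: "deg v \<ge> 1" if "v \<in> e" for v using deg_pos e that by simp
  show ?thesis
  proof (cases "\<exists>v\<in>e - {p}. deg v \<ge> 5")
    case True
    then obtain v where v: "v \<in> e" "v \<noteq> p" "deg v \<ge> 5" by auto
    have "card (e - {p} - {v}) = 2" using fin v by simp
    then have "e - {p} - {v} \<noteq> {}" by (metis card.empty zero_neq_numeral)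
    then obtain u where u: "u \<in> e" "u \<noteq> p" "u \<noteq> v" by blast
    have "\<not> deg u \<ge> 2" using greedy[OF e(1) u(1) v(1) e(2)] u v e(3) by blast
    then have "deg u = 1" using pos[OF u(1)] by simp
    then have "u \<in> e \<inter> W" "1 = 1 / real (deg u)" using S u by auto
    then have "1 \<le> (\<Sum>v\<in>e \<inter> W. 1 / real (deg v))"
      using fin member_le_sum[of u "e \<inter> W" "\<lambda>v. 1 / real (deg v)"] by auto
    then show ?thesis by simp
  next
    case False
    have "3 / 4 = (\<Sum>v\<in>e - {p}. 1 / 4 :: real)" using fin by simp
    also have "\<dots> \<le> (\<Sum>v\<in>e - {p}. 1 / real (deg v))"
    proof (rule sum_mono)
      fix v assume v: "v \<in> e - {p}"
      then have "deg v < 5" "deg v \<ge> 1" using False pos by (auto simp: not_le)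
      then show "1 / 4 \<le> 1 / real (deg v)" by (intro divide_left_mono) auto
    qed
    also have "\<dots> \<le> (\<Sum>v\<in>e \<inter> W. 1 / real (deg v))"
    proof (rule sum_mono2)
      have "deg v < 8" if "v \<in> e - {p}" for v
      proof -
        have "deg v < 5" using False that by (auto simp: not_le)
        then show ?thesis by simp
      qed
      then show "e - {p} \<subseteq> e \<inter> W" using S by auto
    qed (use fin in auto)
    finally show ?thesis by simp
  qed
qed

text \<open>Discharging: every point of degree below \<open>8\<close> has charge \<open>1\<close>, which it splits equally among its
edges, except that \<open>donor e\<close>, for a deficient edge \<open>e\<close>, gives everything to \<open>e\<close>. Then every
edge receives at least \<open>9 / 14\<close>.\<close>

theorem edge_bound:
  assumes V: "finite V" "\<Union>E \<subseteq> V"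
  shows "9 * real (card E) \<le> 14 * (real (card V) - real (card {v \<in> V. deg v \<ge> 8}))"
proof -
  define donor where "donor e = (SOME a. a \<in> e \<and> deg a = 7 \<and> (\<exists>b\<in>e. b \<noteq> a \<and> deg b = 7) \<and>
    (\<forall>f\<in>star e a. (\<forall>x\<in>f - {a}. deg x \<le> 6) \<and> (\<Sum>x\<in>f - {a}. deg x) \<le> 14))" for e
  have donor: "donor e \<in> e \<and> deg (donor e) = 7 \<and> (\<exists>b\<in>e. b \<noteq> donor e \<and> deg b = 7) \<and>
    (\<forall>f\<in>star e (donor e). (\<forall>x\<in>f - {donor e}. deg x \<le> 6) \<and> (\<Sum>x\<in>f - {donor e}. deg x) \<le> 14)"
    if "deficient e" for e
    unfolding donor_def by (rule someI_ex[OF deficient_donor[OF that]])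
  define Deficient where "Deficient = {e \<in> E. deficient e}"
  define S where "S = donor ` Deficient"
  define Low where "Low = {v \<in> V. deg v < 8}"
  define W where "W = Low - S"
  have finDeficient: "finite Deficient" and finLow: "finite Low" and finW: "finite W"
    using finE V by (auto simp: Deficient_def Low_def W_def)
  \<comment> \<open>a second deficient edge with this donor would be a row, with all other degrees at most \<open>6\<close>\<close>
  have inj: "inj_on donor Deficient"
  proof (rule inj_onI, rule ccontr)
    fix e f assume ef: "e \<in> Deficient" "f \<in> Deficient" "donor e = donor f" "e \<noteq> f"
    then have b: "deficient e" "deficient f" "f \<in> E" by (auto simp: Deficient_def)
    have "f \<in> star e (donor e)" using ef donor[OF b(2)] b by (simp add: star_def)
    then have le6: "\<forall>x\<in>f - {donor e}. deg x \<le> 6" using donor[OF b(1)] by blast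
    obtain v where v: "v \<in> f" "v \<noteq> donor f" "deg v = 7" using donor[OF b(2)] by blast
    then have "v \<in> f - {donor e}" using ef(3) by simp
    then have "deg v \<le> 6" using le6 by blast
    then show False using v by simp
  qed
  have S7: "deg v = 7" if "v \<in> S" for v using that donor by (auto simp: S_def Deficient_def)
  have EV: "v \<in> V" if "f \<in> E" "v \<in> f" for f v using V that by auto
  have "S \<subseteq> Low"
  proof
    fix v assume v: "v \<in> S"
    then obtain e where "e \<in> E" "v \<in> e" using donor by (auto simp: S_def Deficient_def)
    then show "v \<in> Low" using EV S7[OF v] by (simp add: Low_def)
  qed
  then have "card Low = card W + card S"
    using card_mono[OF finLow] finLow
    by (simp add: W_def card_Diff_subset finite_subset)
  then have cLow: "card Low = card W + card Deficient" using inj by (simp add: S_def card_image)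
  have charge: "9 / 14 \<le> (\<Sum>v\<in>f \<inter> W. 1 / real (deg v)) + (if f \<in> Deficient then 1 else 0)"
    if f: "f \<in> E" for f
  proof -
    have finf: "finite f" "card f = 4" using f fin_edge card4 by auto
    consider "f \<in> Deficient" | "f \<notin> Deficient" "f \<inter> S \<noteq> {}" | "f \<notin> Deficient" "f \<inter> S = {}" by blast
    then show ?thesis
    proof cases
      case 1
      have "0 \<le> (\<Sum>v\<in>f \<inter> W. 1 / real (deg v))" by (intro sum_nonneg) simp
      then show ?thesis using 1 by simp
    next
      case 2
      then obtain e where e: "e \<in> Deficient" "donor e \<in> f" by (auto simp: S_def)
      then have be: "deficient e" by (simp add: Deficient_def)
      have "f \<in> star e (donor e)" using e 2 f by (auto simp: star_def)
      then have le6: "\<forall>x\<in>f - {donor e}. deg x \<le> 6" and le14: "(\<Sum>x\<in>f - {donor e}. deg x) \<le> 14"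
        using donor[OF be] by blast+
      have "card (f - {donor e}) = 3" using finf e by simp
      then obtain x y z where xyz: "f - {donor e} = {x, y, z}" "x \<noteq> y" "y \<noteq> z" "x \<noteq> z"
        by (auto simp: card_3_iff)
      have "x \<in> f" "y \<in> f" "z \<in> f" using xyz(1) by blast+
      then have pos: "deg x \<ge> 1" "deg y \<ge> 1" "deg z \<ge> 1" using deg_pos f by simp_all
      have "deg x + deg y + deg z \<le> 14" using le14 xyz by simp
      then have "9 / 14 \<le> 1 / real (deg x) + 1 / real (deg y) + 1 / real (deg z)"
        using pos by (intro inverse_sum3) auto
      also have "\<dots> = (\<Sum>v\<in>f - {donor e}. 1 / real (deg v))" using xyz by simp
      also have "\<dots> \<le> (\<Sum>v\<in>f \<inter> W. 1 / real (deg v))"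
      proof (rule sum_mono2)
        show "f - {donor e} \<subseteq> f \<inter> W"
        proof
          fix v assume v: "v \<in> f - {donor e}"
          then have "deg v \<le> 6" using le6 by blast
          then have "v \<notin> S" "deg v < 8" using S7[of v] by auto
          then show "v \<in> f \<inter> W" using v EV[OF f] by (simp add: W_def Low_def)
        qed
      qed (use finf in auto)
      finally show ?thesis using 2 by simp
    next
      case 3
      have inW: "v \<in> W" if "v \<in> f" "deg v < 8" for v
        using that 3 EV[OF f] by (auto simp: W_def Low_def)
      show ?thesis
      proof (cases "\<forall>v\<in>f. deg v < 8")
        case True
        then have "f \<inter> W = f" using inW by auto
        moreover have "\<not> deficient f" using 3 f by (simp add: Deficient_def)
        ultimately show ?thesis using weight_not_deficient[OF f True] 3 by simp
      next
        case False
        then obtain p where "p \<in> f" "deg p \<ge> 8" by (auto simp: not_less)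
        then show ?thesis using weight_high[OF f _ _, of p W] inW 3 by simp
      qed
    qed
  qed
  have "9 / 14 * real (card E) = (\<Sum>f\<in>E. 9 / 14)" by simp
  also have "\<dots> \<le> (\<Sum>f\<in>E. (\<Sum>v\<in>f \<inter> W. 1 / real (deg v)) + (if f \<in> Deficient then 1 else 0))"
    by (intro sum_mono charge)
  also have "\<dots> = (\<Sum>f\<in>E. \<Sum>v | v \<in> W \<and> v \<in> f. 1 / real (deg v)) + real (card Deficient)"
  proof -
    have "f \<inter> W = {v. v \<in> W \<and> v \<in> f}" for f by auto
    moreover have "E \<inter> Deficient = Deficient" by (auto simp: Deficient_def)
    ultimately show ?thesis using finE by (simp add: sum.distrib sum.If_cases)
  qed
  also have "(\<Sum>f\<in>E. \<Sum>v | v \<in> W \<and> v \<in> f. 1 / real (deg v)) =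
      (\<Sum>v\<in>W. \<Sum>f | f \<in> E \<and> v \<in> f. 1 / real (deg v))"
    by (rule sum.swap_restrict[OF finE finW])
  also have "\<dots> \<le> (\<Sum>v\<in>W. 1)"
    by (intro sum_mono) (simp add: deg_def)
  finally have "9 / 14 * real (card E) \<le> real (card Low)" using cLow by simp
  moreover have "card V = card Low + card {v \<in> V. deg v \<ge> 8}"
  proof -
    have "V = Low \<union> {v \<in> V. deg v \<ge> 8}" "Low \<inter> {v \<in> V. deg v \<ge> 8} = {}" by (auto simp: Low_def)
    then show ?thesis using card_Un_disjoint[of Low "{v \<in> V. deg v \<ge> 8}"] finLow V by simp
  qed
  ultimately show ?thesis by simp
qed

end

section \<open>The Turan number\<close>

theorem theorem1p2:
  fixes n :: nat
  assumes "n > 0"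
  shows "int (ex_lin4 n E4_plus) \<ge> 12 * \<lfloor>(real n - 4) / 9\<rfloor> + lower_eps (int n - 4)
    \<and> (\<forall>G :: 'a hypergraph.
          four_uniform G \<and> linear_hypergraph G \<and> card (verts G) = n \<and> free_of E4_plus G \<longrightarrow>
          real (card (edges G))
            \<le> 14 * (real n - real (card {v \<in> verts G. degree G v \<ge> 8})) / 9)"
proof (intro conjI allI impI)
  show "int (ex_lin4 n E4_plus) \<ge> 12 * \<lfloor>(real n - 4) / 9\<rfloor> + lower_eps (int n - 4)"
  proof (cases "n < 4")
    \<comment> \<open>then the floor is negative, so the right-hand side is at most \<open>8 - 12\<close>\<close>
    case True
    then have "\<lfloor>(real n - 4) / 9\<rfloor> \<le> -1" by (simp add: floor_le_iff)
    moreover have "lower_eps (int n - 4) \<le> 8" by (simp add: lower_eps_def)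
    ultimately show ?thesis by linarith
  next
    case False
    define k r where "k = (n - 4) div 9" and "r = (n - 4) mod 9"
    have r: "r < 9" by (simp add: r_def)
    have n: "n = 4 + 9 * k + r"
      using False div_mult_mod_eq[of "n - 4" 9] unfolding k_def r_def by linarith
    have "\<lfloor>(real n - 4) / 9\<rfloor> = int k"
      using r by (intro floor_unique) (simp_all add: n)
    moreover have "lower_eps (int n - 4) = lower_eps (int r)"
    proof -
      have "int n - 4 = int r + int k * 9" by (simp add: n)
      then have "(int n - 4) mod 9 = int r mod 9" by simp
      then show ?thesis by (simp add: lower_eps_def)
    qed
    moreover have "12 * int k + int (card (partial_block r)) \<le> int (ex_lin4 n E4_plus)"
      using ex_lin4_E4_plus_ge[OF r, of k] unfolding n by linarith
    ultimately show ?thesis using card_partial_block[OF r] by simp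
  qed
next
  fix G :: "'a hypergraph"
  assume G: "four_uniform G \<and> linear_hypergraph G \<and> card (verts G) = n \<and> free_of E4_plus G"
  have sub: "finite (verts G)" "\<Union>(edges G) \<subseteq> verts G" using G by (auto simp: four_uniform_def)
  interpret E4_plus_free "edges G"
  proof
    show "finite (edges G)"
      using sub by (intro finite_subset[of "edges G" "Pow (verts G)"]) auto
    show "card e = 4" if "e \<in> edges G" for e using G that by (simp add: four_uniform_def)
    show "e = f" if "e \<in> edges G" "f \<in> edges G" "x \<in> e" "x \<in> f" "y \<in> e" "y \<in> f" "x \<noteq> y" for e f x y
    proof -
      have "x \<in> verts G" "y \<in> verts G" using sub that by blast+
      then show ?thesis using G that unfolding linear_hypergraph_def by blast
    qed
    show False if "e \<in> edges G" "f \<in> edges G" "g \<in> edges G" "h \<in> edges G"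
      "p \<in> e" "q \<in> e" "r \<in> e" "p \<in> f" "q \<in> g" "r \<in> h"
      "f \<inter> g = {}" "f \<inter> h = {}" "g \<inter> h = {}" for e f g h p q r
      using free_of_E4_plusD[of G e f g h p q r] G that by blast
  qed
  have "deg v = degree G v" for v by (simp add: deg_def degree_def)
  then show "real (card (edges G))
      \<le> 14 * (real n - real (card {v \<in> verts G. degree G v \<ge> 8})) / 9"
    using edge_bound[OF sub] G by simp
qed

end
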